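(* Let $N\ge 2$ and let $\mathbb{Q}=\mathbb{L}D\mathbb{M}\in\mathbb{R}^{N\times N}$. Assume that either (A) $D=I$, or (B) $D\neq I$ and $\mathbb{L}D\mathbb{M}=\mathbb{M}D\mathbb{L}$. Then the origin of the linear system $\dot{x}(t)=-\mathbb{Q}x(t)$, $x(t)\in\mathbb{R}^N$, $x(0)=x_0$, is globally exponentially stable on $H^1$. Moreover, the rate of convergence $\eta$ is the smallest strictly positive eigenvalue of $\mathbb{Q}$.
   Context: $\mathcal{G}_c$ is an undirected connected graph with node set $\{1,\dots,N\}$ and edge weights $a_{ij}=a_{ji}>0$; $\mathbb{L}=k_I\mathcal{L}(\mathcal{G}_c)$ with $k_I>0$ a constant. $\mathcal{G}_{el}$ is a weakly connected directed graph with the same node set and positive edge weights; $\mathbb{M}=\mathcal{L}(\mathcal{G}_{el})$. The Laplacian of a weighted (di)graph with incidence matrix $B$ and diagonal matrix $W$ of edge weights is $\mathcal{L}=BWB^T$ (independent of edge orientations). $D=\mathrm{diag}(d_1,\dots,d_N)$ with all $d_i>0$. $H^1=\{v\in\mathbb{R}^N: \frac1N\sum_i v_i=0\}$, with orthogonal complement $H^1_\perp=\{\alpha\mathbf{1}_N:\alpha\in\mathbb{R}\}$. Definition: for a subspace $\mathcal{V}\subseteq\mathbb{R}^n$ with orthogonal projection $P_{\mathcal{V}}$, the origin of $\dot x=\mathcal{A}x$ is globally exponentially stable on $\mathcal{V}$ if there exist $\kappa,\eta>0$ such that $\|P_{\mathcal{V}}x(t)\|\le\kappa e^{-\eta t}\|P_{\mathcal{V}}x(0)\|$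 for all $t\ge0$ and all solutions $x$; the parameter $\eta$ is called the rate of convergence. Thus the last claim says that the estimate holds with $\eta$ equal to the smallest strictly positive eigenvalue of $\mathbb{Q}$. *)

theory Defs
  imports "HOL-Analysis.Analysis" "Graph_Theory.Graph_Theory"
begin

definition diag_matrix :: "('n \<Rightarrow> 'a::zero) \<Rightarrow> 'a^'n^'n" where
  "diag_matrix d = (\<chi> i j. if i = j then d i else 0)"

text \<open>
  Columns are indexed by the whole arc type; those outside \<open>arcs G\<close> are zero, so they
  contribute nothing to \<open>B W B\<^sup>T\<close>, whatever the value of \<open>w\<close> there.
\<close>

definition incidence_matrix :: "('n, 'e) pre_digraph \<Rightarrow> real^'e^'n" where
  "incidence_matrix G =
     (\<chi> v e. if e \<in> arcs G
              then (if v = head G e then 1 else 0) - (if v = tail G e then 1 else 0)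
              else 0)"

definition laplacian :: "('n, 'e::finite) pre_digraph \<Rightarrow> ('e \<Rightarrow> real) \<Rightarrow> real^'n^'n" where
  "laplacian G w =
     incidence_matrix G ** diag_matrix w ** transpose (incidence_matrix G)"

text \<open>
  An undirected graph is a symmetric digraph (\<^locale>\<open>pair_graph\<close>), which contains each edge in
  both directions. Its incidence matrix has one column per edge, so it is the incidence matrix
  of an orientation, i.e. of a choice of exactly one direction for each edge.
\<close>

definition orientation_of :: "'n pair_pre_digraph \<Rightarrow> 'n pair_pre_digraph \<Rightarrow> bool" where
  "orientation_of H G \<longleftrightarrow>
     pverts H = pverts G \<and>
     parcs H \<union> (parcs H)\<inverse> = parcs G \<and>
     parcs H \<inter> (parcs H)\<inverse> = {}"

lemma (in pair_graph) orientation_exists: "\<exists>H. orientation_of H G"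
proof -
  obtain f :: "'a \<Rightarrow> nat" where f: "inj_on f (pverts G)"
    using finite_imp_inj_to_nat_seg[OF pair_finite_verts] by blast
  have sym: "(v, u) \<in> parcs G" if "(u, v) \<in> parcs G" for u v
    using that pair_sym_arcs by (auto simp: symmetric_def dest: symD)
  have neq: "f u \<noteq> f v" if "(u, v) \<in> parcs G" for u v
    using that f pair_no_loops[OF that] arc_fst_in_verts[OF that] arc_snd_in_verts[OF that]
    by (auto dest: inj_onD)
  let ?H = "\<lparr>pverts = pverts G, parcs = {(u, v). (u, v) \<in> parcs G \<and> f u < f v}\<rparr>"
  have "orientation_of ?H G"
    unfolding orientation_of_def using sym neq by (fastforce simp: neq_iff)
  then show ?thesis ..
qed

definition mean_zero_space :: "(real^'n) set" where
  "mean_zero_space = {v. (1 / real CARD('n)) * (\<Sum>i\<in>UNIV. v $ i) = 0}"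

definition orth_proj :: "'a::euclidean_space set \<Rightarrow> 'a \<Rightarrow> 'a" where
  "orth_proj V x = (THE p. p \<in> V \<and> (\<forall>v\<in>V. orthogonal (x - p) v))"

definition solves_linear_ode :: "real^'n^'n \<Rightarrow> (real \<Rightarrow> real^'n) \<Rightarrow> bool" where
  "solves_linear_ode A x \<longleftrightarrow>
     (\<forall>t\<ge>0. (x has_vector_derivative A *v x t) (at t within {0..}))"

definition glob_exp_stable_on_rate :: "real^'n^'n \<Rightarrow> (real^'n) set \<Rightarrow> real \<Rightarrow> bool" where
  "glob_exp_stable_on_rate A V \<eta> \<longleftrightarrow>
     \<eta> > 0 \<and>
     (\<exists>\<kappa>>0. \<forall>x. solves_linear_ode A x \<longrightarrow>
        (\<forall>t\<ge>0. norm (orth_proj V (x t)) \<le> \<kappa> * exp (- \<eta> * t) * norm (orth_proj V (x 0))))"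

definition glob_exp_stable_on :: "real^'n^'n \<Rightarrow> (real^'n) set \<Rightarrow> bool" where
  "glob_exp_stable_on A V \<longleftrightarrow> (\<exists>\<eta>. glob_exp_stable_on_rate A V \<eta>)"

definition is_eigenvalue :: "'a::field^'n^'n \<Rightarrow> 'a \<Rightarrow> bool" where
  "is_eigenvalue A c \<longleftrightarrow> (\<exists>v. v \<noteq> 0 \<and> A *v v = c *s v)"

definition is_least_pos_eigenvalue :: "real^'n^'n \<Rightarrow> real \<Rightarrow> bool" where
  "is_least_pos_eigenvalue A \<eta> \<longleftrightarrow>
     is_eigenvalue A \<eta> \<and> \<eta> > 0 \<and> (\<forall>\<mu>. is_eigenvalue A \<mu> \<and> \<mu> > 0 \<longrightarrow> \<eta> \<le> \<mu>)"

end

theory Submission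
  imports Defs
begin

text \<open>
  In both cases there is a symmetric matrix \<open>A\<close>, positive definite on the mean-zero space, such
  that \<open>A Q\<close> is symmetric and positive definite there: \<open>A = M\<close> if \<open>D = I\<close>, since then
  \<open>A Q = M L M\<close>, and \<open>A = I\<close> if \<open>L D M = M D L\<close>. The minimum \<open>\<eta>\<close> of \<open>x \<bullet> A Q x / x \<bullet> A x\<close> on the
  mean-zero space is the least positive eigenvalue of \<open>Q\<close>, and along solutions the
  energy \<open>x \<bullet> A x\<close> of the mean-zero part decays at least like \<open>exp (- 2 \<eta> t)\<close>.
\<close>

section \<open>Quadratic forms on a subspace and Rayleigh quotients\<close>

lemma inner_matrix_symmetric:
  fixes A :: "real^'n^'n"
  assumes "transpose A = A"
  shows "x \<bullet> (A *v y) = (A *v x) \<bullet> y"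
  using assms by (metis dot_lmul_matrix transpose_matrix_vector)

text \<open>Symmetry concerns the whole matrix, positivity only \<open>V\<close>: a Laplacian
  annihilates the constants, so it can be definite only on a complement such as the mean-zero
  space.\<close>

definition pos_def_on :: "real^'n^'n \<Rightarrow> (real^'n) set \<Rightarrow> bool" where
  "pos_def_on A V \<longleftrightarrow> transpose A = A \<and> (\<forall>x\<in>V. x \<noteq> 0 \<longrightarrow> 0 < x \<bullet> (A *v x))"

text \<open>A zero of a form that is nonnegative on \<open>V\<close> is a minimum, so the first
  variation vanishes in every direction of \<open>V\<close>.\<close>

lemma psd_null_vector:
  fixes T :: "real^'n^'n"
  assumes V: "subspace V" and T: "transpose T = T"
    and psd: "\<And>y. y \<in> V \<Longrightarrow> 0 \<le> y \<bullet> (T *v y)"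
    and x: "x \<in> V" "x \<bullet> (T *v x) = 0" and y: "y \<in> V"
  shows "y \<bullet> (T *v x) = 0"
proof (rule ccontr)
  define b c where "b = y \<bullet> (T *v x)" and "c = y \<bullet> (T *v y)"
  assume "y \<bullet> (T *v x) \<noteq> 0"
  then have b: "b \<noteq> 0" by (simp add: b_def)
  have c: "c \<ge> 0" using psd y by (simp add: c_def)
  have xy: "x \<bullet> (T *v y) = b"
    using inner_matrix_symmetric[OF T, of x y] by (simp add: b_def inner_commute)
  \<comment> \<open>The value along the line is \<open>2 * t * b + t\<^sup>2 * c\<close>, with
    minimum at \<open>- b / c\<close>; the denominator \<open>c + 1\<close> also covers
    \<open>c = 0\<close> and still makes the value negative.\<close>
  define t where "t = - b / (c + 1)"
  have "x + t *\<^sub>R y \<in> V"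
    using V x y by (simp add: subspace_add subspace_scale)
  then have "0 \<le> (x + t *\<^sub>R y) \<bullet> (T *v (x + t *\<^sub>R y))" by (rule psd)
  also have "\<dots> = 2 * t * b + t\<^sup>2 * c"
    using x xy by (simp add: matrix_vector_right_distrib matrix_vector_mult_scaleR
        inner_add_left inner_add_right b_def[symmetric] c_def[symmetric] power2_eq_square algebra_simps)
  also have "\<dots> = - (t\<^sup>2 * (c + 2))"
  proof -
    have "b = - t * (c + 1)" using c by (simp add: t_def)
    then show ?thesis
      unfolding \<open>b = - t * (c + 1)\<close> by (simp add: power2_eq_square algebra_simps)
  qed
  also have "\<dots> < 0" using b c by (simp add: t_def)
  finally show False by simp
qed

text \<open>The quotient is invariant under scaling, so its minimum is attained on the compact unit
  sphere of \<open>V\<close>. Then \<open>S - \<mu> *\<^sub>R A\<close> is nonnegative on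
  \<open>V\<close> and its form vanishes at the minimiser, which gives the eigenvalue equation by
  \<open>psd_null_vector\<close>. The equation is tested against \<open>V\<close> only, because
  \<open>S\<close> and \<open>A\<close> may map \<open>V\<close> outside itself.\<close>

lemma rayleigh_minimizer:
  fixes S A :: "real^'n^'n"
  assumes V: "subspace V" "V \<noteq> {0}" and S: "transpose S = S" and A: "pos_def_on A V"
  obtains \<mu> x where "x \<in> V" "x \<noteq> 0" "\<And>y. y \<in> V \<Longrightarrow> y \<bullet> (S *v x) = \<mu> * (y \<bullet> (A *v x))"
    "\<And>y. y \<in> V \<Longrightarrow> \<mu> * (y \<bullet> (A *v y)) \<le> y \<bullet> (S *v y)"
proof -
  define f where "f x = (x \<bullet> (S *v x)) / (x \<bullet> (A *v x))" for x
  define K where "K = sphere 0 1 \<inter> V"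
  have "compact K" unfolding K_def
    using V by (intro compact_Int_closed closed_subspace) auto
  moreover have "K \<noteq> {}"
  proof -
    obtain v where "v \<in> V" "v \<noteq> 0" using V subspace_0 by fastforce
    then have "(1 / norm v) *\<^sub>R v \<in> K" using V by (simp add: K_def subspace_scale)
    then show ?thesis by blast
  qed
  moreover have "continuous_on K f" unfolding f_def
  proof (intro continuous_intros linear_continuous_on linear_continuous_on_compose ballI)
    fix x assume "x \<in> K"
    then show "x \<bullet> (A *v x) \<noteq> 0" using A by (force simp: K_def pos_def_on_def)
  qed
  ultimately have "\<exists>x\<in>K. \<forall>y\<in>K. f x \<le> f y" by (rule continuous_attains_inf)
  then obtain x where xK: "x \<in> K" and min: "\<And>y. y \<in> K \<Longrightarrow> f x \<le> f y" by blast
  define \<mu> where "\<mu> = f x"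
  have x: "x \<in> V" "x \<noteq> 0" using xK by (auto simp: K_def)
  have bound: "\<mu> * (y \<bullet> (A *v y)) \<le> y \<bullet> (S *v y)" if y: "y \<in> V" for y
  proof (cases "y = 0")
    case False
    then have "(1 / norm y) *\<^sub>R y \<in> K" using V y by (simp add: K_def subspace_scale)
    then have "\<mu> \<le> f ((1 / norm y) *\<^sub>R y)" unfolding \<mu>_def by (rule min)
    also have "\<dots> = f y" using False by (simp add: f_def matrix_vector_mult_scaleR)
    finally show ?thesis
      using A False y by (simp add: f_def pos_def_on_def field_simps)
  qed simp
  define T where "T = S - \<mu> *\<^sub>R A"
  have Tv: "T *v y = S *v y - \<mu> *\<^sub>R (A *v y)" for y
    by (simp add: T_def matrix_vector_mult_diff_rdistrib scaleR_matrix_vector_assoc)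
  have "transpose T = transpose S - \<mu> *\<^sub>R transpose A"
    by (simp add: T_def transpose_def vec_eq_iff)
  then have T: "transpose T = T"
    using S A by (simp add: pos_def_on_def T_def)
  have psd: "0 \<le> y \<bullet> (T *v y)" if "y \<in> V" for y
    using bound[OF that] by (simp add: Tv inner_diff_right)
  have "x \<bullet> (A *v x) \<noteq> 0"
    using A x unfolding pos_def_on_def by force
  then have "x \<bullet> (T *v x) = 0"
    by (simp add: Tv inner_diff_right \<mu>_def f_def)
  from psd_null_vector[OF V(1) T psd x(1) this]
  have "y \<bullet> (S *v x) = \<mu> * (y \<bullet> (A *v x))" if "y \<in> V" for y
    using that by (simp add: Tv inner_diff_right)
  from x this bound show ?thesis by (rule that)
qed

section \<open>The mean-zero space and its orthogonal projection\<close>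

lemma mean_zero_space_iff: "(v :: real^'n) \<in> mean_zero_space \<longleftrightarrow> v \<bullet> 1 = 0"
  by (simp add: mean_zero_space_def inner_vec_def)

lemma inner_one_one: "(1 :: real^'n) \<bullet> 1 = real CARD('n)"
  by (simp add: inner_vec_def)

lemma subspace_mean_zero: "subspace (mean_zero_space :: (real^'n) set)"
  by (simp add: subspace_def mean_zero_space_iff inner_add_left)

lemma mean_zero_nontrivial:
  assumes "CARD('n::finite) \<ge> 2"
  shows "(mean_zero_space :: (real^'n) set) \<noteq> {0}"
proof -
  obtain i j :: 'n where ij: "i \<noteq> j"
    using assms ex_card[of 2 "UNIV :: 'n set"] by (auto simp: card_2_iff)
  let ?v = "axis i 1 - axis j 1 :: real^'n"
  have "?v \<in> mean_zero_space"
    by (simp add: mean_zero_space_iff inner_diff_left inner_axis')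
  moreover have "?v \<noteq> 0" using ij by (auto simp: axis_eq_axis)
  ultimately show ?thesis by blast
qed

lemma orth_proj_mean_zero:
  "orth_proj mean_zero_space (x :: real^'n) = x - (x \<bullet> 1 / real CARD('n)) *\<^sub>R 1" (is "_ = ?p")
  unfolding orth_proj_def
proof (rule the_equality)
  have p: "?p \<in> mean_zero_space"
    by (simp add: mean_zero_space_iff inner_diff_left inner_one_one)
  have o: "orthogonal (x - ?p) v" if "v \<in> mean_zero_space" for v
    using that by (simp add: mean_zero_space_iff orthogonal_def inner_commute)
  show "?p \<in> mean_zero_space \<and> (\<forall>v\<in>mean_zero_space. orthogonal (x - ?p) v)"
    using p o by blast
  fix q assume q: "q \<in> mean_zero_space \<and> (\<forall>v\<in>mean_zero_space. orthogonal (x - q) v)"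
  have d: "q - ?p \<in> mean_zero_space"
    using q p subspace_mean_zero subspace_diff by blast
  \<comment> \<open>Uniqueness: both residuals are orthogonal to \<open>q - ?p\<close>, and their
    difference is that very vector.\<close>
  have "(q - ?p) \<bullet> (q - ?p) = (x - ?p) \<bullet> (q - ?p) - (x - q) \<bullet> (q - ?p)"
    by (simp add: inner_diff_left)
  also have "\<dots> = 0" using q o[OF d] d unfolding orthogonal_def by simp
  finally show "q = ?p" by simp
qed

section \<open>Stability from self-adjointness in a weighted inner product\<close>

text \<open>On the mean-zero space \<open>Q\<close> is self-adjoint for the inner product given by
  \<open>A\<close>. Hence the Rayleigh minimum is an eigenvalue and at the same time bounds the
  dissipation of energy, so the rate is attained exactly, without loss of an arbitrarily small
  margin.\<close>

lemma exp_stable_of_weighted_self_adjoint: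
  fixes Q A :: "real^'n^'n"
  assumes card: "CARD('n) \<ge> 2"
    and A: "pos_def_on A mean_zero_space"
    and AQ: "pos_def_on (A ** Q) mean_zero_space"
    and Q1: "Q *v 1 = 0"
    and range: "\<And>v. Q *v v \<in> mean_zero_space"
  shows "\<exists>\<eta>. is_least_pos_eigenvalue Q \<eta> \<and> glob_exp_stable_on_rate (- Q) mean_zero_space \<eta>"
proof -
  let ?H = "mean_zero_space :: (real^'n) set"
  note H = subspace_mean_zero mean_zero_nontrivial[OF card]
  have sym: "transpose (A ** Q) = A ** Q" "transpose A = A"
    using A AQ by (auto simp: pos_def_on_def)
  obtain \<eta> x where x: "x \<in> ?H" "x \<noteq> 0"
    and eq: "\<And>y. y \<in> ?H \<Longrightarrow> y \<bullet> ((A ** Q) *v x) = \<eta> * (y \<bullet> (A *v x))"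
    and le: "\<And>y. y \<in> ?H \<Longrightarrow> \<eta> * (y \<bullet> (A *v y)) \<le> y \<bullet> ((A ** Q) *v y)"
    by (rule rayleigh_minimizer[OF H sym(1) A]) (rule that; assumption)
  have AQv: "(A ** Q) *v v = A *v (Q *v v)" for v
    by (simp add: matrix_vector_mul_assoc)
  \<comment> \<open>The residual is itself mean-zero, hence an admissible test vector; definiteness
    of \<open>A\<close> then turns the tested equation into
    \<open>Q *v x = \<eta> *\<^sub>R x\<close>.\<close>
  define r where "r = Q *v x - \<eta> *\<^sub>R x"
  have rH: "r \<in> ?H" unfolding r_def
    using range x by (intro subspace_diff subspace_scale subspace_mean_zero)
  have "r \<bullet> (A *v r) = 0"
    using eq[OF rH] by (simp add: r_def AQv matrix_vector_mult_diff_distrib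
        matrix_vector_mult_scaleR inner_diff_right)
  then have "r = 0" using A rH by (force simp: pos_def_on_def)
  then have eig: "is_eigenvalue Q \<eta>"
    using x unfolding is_eigenvalue_def r_def by (auto simp: scalar_mult_eq_scaleR)
  have "0 < \<eta> * (x \<bullet> (A *v x))"
    using AQ x eq[of x] by (metis pos_def_on_def)
  then have pos: "\<eta> > 0"
    using A x by (auto simp: pos_def_on_def zero_less_mult_iff)
  have least: "\<eta> \<le> \<mu>" if ev: "is_eigenvalue Q \<mu>" and "\<mu> > 0" for \<mu>
  proof -
    obtain v where v: "v \<noteq> 0" "Q *v v = \<mu> *\<^sub>R v"
      using ev by (auto simp: is_eigenvalue_def scalar_mult_eq_scaleR)
    \<comment> \<open>An eigenvector for a positive eigenvalue is a multiple of its image under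
      \<open>Q\<close>, so it is mean-zero and the Rayleigh bound applies to it.\<close>
    have "(1 / \<mu>) *\<^sub>R (Q *v v) \<in> ?H" by (intro subspace_scale subspace_mean_zero range)
    then have vH: "v \<in> ?H" using v \<open>\<mu> > 0\<close> by simp
    have "\<eta> * (v \<bullet> (A *v v)) \<le> \<mu> * (v \<bullet> (A *v v))"
      using le[OF vH] by (simp add: AQv v matrix_vector_mult_scaleR)
    moreover have "0 < v \<bullet> (A *v v)" using A vH v by (simp add: pos_def_on_def)
    ultimately show ?thesis by simp
  qed
  \<comment> \<open>With the identity as weight, the Rayleigh minimum of \<open>A\<close> is the
    coercivity constant \<open>c\<close>.\<close>
  have I: "pos_def_on (mat 1) ?H" by (simp add: pos_def_on_def transpose_mat)
  obtain c where c: "c > 0" "\<And>y. y \<in> ?H \<Longrightarrow> c * (norm y)\<^sup>2 \<le> y \<bullet> (A *v y)"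
  proof -
    obtain c z where z: "z \<in> ?H" "z \<noteq> 0"
      and eqc: "\<And>y. y \<in> ?H \<Longrightarrow> y \<bullet> (A *v z) = c * (y \<bullet> (mat 1 *v z))"
      and lec: "\<And>y. y \<in> ?H \<Longrightarrow> c * (y \<bullet> (mat 1 *v y)) \<le> y \<bullet> (A *v y)"
      by (rule rayleigh_minimizer[OF H sym(2) I]) (rule that; assumption)
    have "0 < z \<bullet> (A *v z)" using A z by (simp add: pos_def_on_def)
    then have "0 < c" using eqc[of z] z by (intro zero_less_mult_pos2[of c "z \<bullet> z"]) auto
    with lec show ?thesis by (intro that[of c]) (auto simp: power2_norm_eq_inner)
  qed
  obtain B where B: "B > 0" "\<And>y. norm (A *v y) \<le> B * norm y"
    using linear_bounded_pos[OF matrix_vector_mul_linear[of A]] by blast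
  \<comment> \<open>The energy lies between \<open>c\<close> and \<open>B\<close> times the squared
    norm, so returning from energy to norm costs the square root of the ratio.\<close>
  define \<kappa> where "\<kappa> = sqrt (B / c)"
  have \<kappa>: "\<kappa> > 0" using B c by (simp add: \<kappa>_def)
  have decay: "norm (orth_proj ?H (u t)) \<le> \<kappa> * exp (- \<eta> * t) * norm (orth_proj ?H (u 0))"
    if u: "solves_linear_ode (- Q) u" and t: "t \<ge> 0" for u t
  proof -
    \<comment> \<open>The projected solution obeys the same equation: \<open>Q\<close> does not see
      the constant part that is removed, and the mean of \<open>u\<close> has derivative
      zero.\<close>
    define p where "p s = u s - (u s \<bullet> 1 / real CARD('n)) *\<^sub>R 1" for s
    have p_proj: "orth_proj ?H (u s) = p s" for s
      by (simp add: p_def orth_proj_mean_zero)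
    have pH: "p s \<in> ?H" for s
      by (simp add: p_def mean_zero_space_iff inner_diff_left inner_one_one)
    have Qp: "Q *v p s = Q *v u s" for s
      by (simp add: p_def matrix_vector_mult_diff_distrib matrix_vector_mult_scaleR Q1)
    have Q_orth: "(Q *v v) \<bullet> 1 = 0" for v using range by (simp add: mean_zero_space_iff)
    have neg: "(- Q) *v v = - (Q *v v)" for v
      by (simp add: matrix_vector_mult_def vec_eq_iff sum_negf)
    have dp: "(p has_vector_derivative - (Q *v p s)) (at s within {0..})" if "s \<ge> 0" for s
    proof -
      have du: "(u has_vector_derivative - (Q *v u s)) (at s within {0..})"
        using u that by (simp add: solves_linear_ode_def neg)
      have bl: "bounded_linear (\<lambda>v :: real^'n. v - (v \<bullet> 1 / real CARD('n)) *\<^sub>R 1)"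
        by (intro bounded_linear_sub bounded_linear_ident bounded_linear_scaleR_const
            bounded_linear_divide bounded_linear_inner_left bounded_linear_compose[OF bounded_linear_divide])
      from bounded_linear.has_vector_derivative[OF bl du]
      show ?thesis by (simp add: p_def[abs_def] Q_orth Qp[symmetric, unfolded p_def])
    qed
    \<comment> \<open>The exponential factor turns the claimed decay of energy into monotonicity: by
      the Rayleigh bound the derivative of \<open>E\<close> is at most zero.\<close>
    define E where "E s = exp (2 * \<eta> * s) * (p s \<bullet> (A *v p s))" for s
    have dE: "(E has_real_derivative
        exp (2 * \<eta> * s) * (2 * \<eta> * (p s \<bullet> (A *v p s)) - 2 * (p s \<bullet> ((A ** Q) *v p s))))
        (at s within {0..})" if "s \<ge> 0" for s
    proof -
      have dA: "((\<lambda>s. A *v p s) has_vector_derivative A *v (- (Q *v p s))) (at s within {0..})"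
        by (rule bounded_linear.has_vector_derivative[OF matrix_vector_mul_bounded_linear dp[OF that]])
      have "((\<lambda>s. p s \<bullet> (A *v p s)) has_vector_derivative
          (p s \<bullet> (A *v (- (Q *v p s))) + (- (Q *v p s)) \<bullet> (A *v p s))) (at s within {0..})"
        by (rule bounded_bilinear.has_vector_derivative[OF bounded_bilinear_inner dp[OF that] dA])
      also have "(- (Q *v p s)) \<bullet> (A *v p s) = p s \<bullet> (A *v (- (Q *v p s)))"
        using inner_matrix_symmetric[OF sym(2), of "- (Q *v p s)" "p s"] by (metis inner_commute)
      also have "A *v (- (Q *v p s)) = - ((A ** Q) *v p s)"
        by (simp add: AQv vec.neg)
      finally have dV: "((\<lambda>s. p s \<bullet> (A *v p s)) has_real_derivative
          - 2 * (p s \<bullet> ((A ** Q) *v p s))) (at s within {0..})"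
        by (simp add: has_real_derivative_iff_has_vector_derivative)
      show ?thesis unfolding E_def
        by (rule derivative_eq_intros dV refl | simp add: algebra_simps)+
    qed
    have "E t \<le> E 0"
    proof (rule DERIV_nonpos_imp_decreasing_open[OF t])
      fix s assume s: "0 < s" "s < t"
      \<comment> \<open>The differential equation supplies derivatives within the half-line; at
        interior times they are two-sided, and at time 0 continuity suffices.\<close>
      have "at s within {0..} = at s"
        using s by (intro at_within_interior) (simp add: interior_Ici[of "-1"])
      with dE[of s] s le[OF pH[of s]] show "\<exists>y. DERIV E s :> y \<and> y \<le> 0"
        by (intro exI conjI) (auto simp: mult_le_0_iff)
    next
      have "continuous_on {0..} E"
        using dE by (intro DERIV_continuous_on) auto
      then show "continuous_on {0..t} E" by (rule continuous_on_subset) auto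
    qed
    moreover have "E 0 \<le> B * (norm (p 0))\<^sup>2"
    proof -
      have "p 0 \<bullet> (A *v p 0) \<le> norm (p 0) * norm (A *v p 0)" by (rule norm_cauchy_schwarz)
      also have "\<dots> \<le> norm (p 0) * (B * norm (p 0))"
        by (rule mult_left_mono[OF B(2)]) simp
      finally show ?thesis by (simp add: E_def power2_eq_square mult_ac)
    qed
    moreover have "exp (2 * \<eta> * t) * (c * (norm (p t))\<^sup>2) \<le> E t"
      unfolding E_def by (rule mult_left_mono[OF c(2)[OF pH]]) simp
    ultimately have "exp (2 * \<eta> * t) * (c * (norm (p t))\<^sup>2) \<le> B * (norm (p 0))\<^sup>2" by linarith
    then have "(exp (\<eta> * t) * norm (p t))\<^sup>2 \<le> B / c * (norm (p 0))\<^sup>2"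
      using c(1) by (simp add: field_simps power_mult_distrib exp_double[symmetric] mult.assoc)
    then have "exp (\<eta> * t) * norm (p t) \<le> sqrt (B / c * (norm (p 0))\<^sup>2)"
      by (rule real_le_rsqrt)
    then have "exp (\<eta> * t) * norm (p t) \<le> \<kappa> * norm (p 0)"
      unfolding \<kappa>_def real_sqrt_mult by simp
    then show ?thesis
      unfolding p_proj by (simp add: exp_minus field_simps)
  qed
  show ?thesis
    using eig pos least decay \<kappa>
    unfolding is_least_pos_eigenvalue_def glob_exp_stable_on_rate_def by blast
qed

section \<open>Diagonal matrices and graph Laplacians\<close>

lemma transpose_diag_matrix [simp]: "transpose (diag_matrix d) = diag_matrix d"
  by (auto simp: transpose_def diag_matrix_def vec_eq_iff)

lemma diag_matrix_mult_vec: "(diag_matrix d *v x) $ i = d i * (x $ i :: real)"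
  by (simp add: diag_matrix_def matrix_vector_mult_def if_distrib[of "\<lambda>z. z * _"] cong: if_cong)

lemma inner_diag_matrix: "x \<bullet> (diag_matrix d *v y) = (\<Sum>i\<in>UNIV. d i * (x $ i) * (y $ i))"
  by (simp add: inner_vec_def diag_matrix_mult_vec mult_ac)

lemma pos_def_diag_matrix:
  assumes "\<And>i. d i > 0"
  shows "pos_def_on (diag_matrix d :: real^'n^'n) UNIV"
  unfolding pos_def_on_def
proof (intro conjI ballI impI)
  fix x :: "real^'n" assume "x \<noteq> 0"
  then obtain i where i: "x $ i \<noteq> 0" by (auto simp: vec_eq_iff)
  have "0 < (x $ i) * (x $ i)" using i not_real_square_gt_zero by blast
  then have "0 < d i * (x $ i) * (x $ i)" using assms[of i] by (simp only: mult.assoc mult_pos_pos)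
  moreover have "0 \<le> d j * (x $ j) * (x $ j)" for j
    using assms[of j] by (simp add: mult.assoc)
  ultimately show "0 < x \<bullet> (diag_matrix d *v x)"
    unfolding inner_diag_matrix by (intro sum_pos2[of _ i]) auto
qed simp

lemma transpose_laplacian [simp]: "transpose (laplacian G w) = laplacian G w"
  by (simp add: laplacian_def matrix_transpose_mul matrix_mul_assoc)

lemma transpose_incidence_mult_vec:
  "(transpose (incidence_matrix G) *v x) $ e =
     (if e \<in> arcs G then x $ head G e - x $ tail G e else 0)"
  by (simp add: incidence_matrix_def transpose_def matrix_vector_mult_def left_diff_distrib
      sum_subtractf if_distrib[of "\<lambda>z. z * _"] cong: if_cong)

text \<open>Moving the incidence matrix across the inner product leaves a diagonal form in the
  differences of \<open>x\<close> along arcs; indices outside \<open>arcs G\<close> contribute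
  zero.\<close>

lemma laplacian_quadratic_form:
  "x \<bullet> (laplacian G w *v x) = (\<Sum>e\<in>arcs G. w e * (x $ head G e - x $ tail G e)\<^sup>2)"
proof -
  let ?B = "incidence_matrix G"
  have "x \<bullet> (laplacian G w *v x) =
      (transpose ?B *v x) \<bullet> (diag_matrix w *v (transpose ?B *v x))"
    unfolding laplacian_def matrix_vector_mul_assoc[symmetric]
    by (simp add: dot_lmul_matrix)
  also have "\<dots> = (\<Sum>e\<in>UNIV. if e \<in> arcs G then w e * (x $ head G e - x $ tail G e)\<^sup>2 else 0)"
    unfolding inner_diag_matrix transpose_incidence_mult_vec
    by (intro sum.cong) (auto simp: power2_eq_square)
  also have "\<dots> = (\<Sum>e\<in>arcs G. w e * (x $ head G e - x $ tail G e)\<^sup>2)"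
    by (simp add: sum.If_cases)
  finally show ?thesis .
qed

lemma laplacian_mult_one: "laplacian G w *v 1 = 0"
proof -
  have "transpose (incidence_matrix G) *v 1 = 0"
    unfolding vec_eq_iff transpose_incidence_mult_vec by simp
  then show ?thesis
    unfolding laplacian_def matrix_vector_mul_assoc[symmetric] by simp
qed

text \<open>Connectedness means reachability in the symmetric closure. A path may traverse an arc
  backwards, which is harmless because equality of values is symmetric.\<close>

lemma connected_imp_const:
  assumes conn: "Digraph_Component.connected (with_proj G)"
    and step: "\<And>i j. (i, j) \<in> parcs G \<Longrightarrow> f i = f j"
    and ij: "i \<in> pverts G" "j \<in> pverts G"
  shows "f i = f j"
proof -
  let ?S = "mk_symmetric (with_proj G)"
  have "i \<rightarrow>\<^sup>*\<^bsub>with_proj ?S\<^esub> j"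
    using conn ij by (auto simp: Digraph_Component.connected_def)
  then have "(i, j) \<in> rtrancl_on (pverts ?S) (parcs ?S)"
    by (simp add: reachable_def)
  then show ?thesis
  proof (induction rule: rtrancl_on_induct)
    case (step x y)
    then have "(x, y) \<in> parcs G \<or> (y, x) \<in> parcs G"
      by (auto simp: parcs_mk_symmetric)
    then show ?case using assms(2) step.IH by metis
  qed simp
qed

lemma const_mean_zero:
  fixes x :: "real^'n"
  assumes "x \<in> mean_zero_space" "\<And>i j. x $ i = x $ j"
  shows "x = 0"
proof -
  have "x = (x $ undefined) *\<^sub>R 1"
    unfolding vec_eq_iff using assms(2) by auto
  then obtain c where "x = c *\<^sub>R 1" ..
  then show ?thesis using assms(1) by (simp add: mean_zero_space_iff inner_one_one)
qed

text \<open>The arcs of \<open>H\<close> may be a choice of directions for those of the connected graph \<open>G\<close>.\<close>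

lemma pos_def_laplacian:
  fixes G H :: "('n::finite) pair_pre_digraph"
  assumes conn: "Digraph_Component.connected (with_proj G)" and verts: "pverts G = UNIV"
    and arcs: "parcs G \<subseteq> parcs H \<union> (parcs H)\<inverse>"
    and w: "\<And>e. e \<in> parcs H \<Longrightarrow> w e > 0"
  shows "pos_def_on (laplacian (with_proj H) w) mean_zero_space"
  unfolding pos_def_on_def
proof (intro conjI ballI impI transpose_laplacian)
  fix x :: "real^'n" assume x: "x \<in> mean_zero_space" "x \<noteq> 0"
  let ?q = "\<lambda>e. w e * (x $ snd e - x $ fst e)\<^sup>2"
  have q: "0 \<le> ?q e" if "e \<in> parcs H" for e using w[OF that] by simp
  have form: "x \<bullet> (laplacian (with_proj H) w *v x) = (\<Sum>e\<in>parcs H. ?q e)"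
    by (simp add: laplacian_quadratic_form)
  \<comment> \<open>The sum is nonnegative, so it remains to exclude zero: then every term vanishes,
    \<open>x\<close> is constant along arcs, hence everywhere, and a constant mean-zero vector is
    zero.\<close>
  have "(\<Sum>e\<in>parcs H. ?q e) \<noteq> 0"
  proof
    assume "(\<Sum>e\<in>parcs H. ?q e) = 0"
    then have z: "?q e = 0" if "e \<in> parcs H" for e
      using that q by (subst (asm) sum_nonneg_eq_0_iff) auto
    have "x $ i = x $ j" if "(i, j) \<in> parcs H" for i j
      using z[OF that] w[OF that] by simp
    then have "x $ i = x $ j" if "(i, j) \<in> parcs G" for i j
      using that arcs by fastforce
    then have "x $ i = x $ j" for i j
      using connected_imp_const[OF conn, of "\<lambda>i. x $ i"] verts by blast
    with x show False using const_mean_zero by blast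
  qed
  then show "0 < x \<bullet> (laplacian (with_proj H) w *v x)"
    unfolding form using sum_nonneg[of "parcs H" ?q] q by fastforce
qed

section \<open>Kernels, ranges and positive definite products\<close>

text \<open>The range of a symmetric matrix is orthogonal to its kernel, which contains the vector
  of ones.\<close>

lemma range_mean_zero:
  assumes "transpose A = A" "A *v 1 = 0"
  shows "A *v v \<in> (mean_zero_space :: (real^'n) set)"
  using inner_matrix_symmetric[OF assms(1), of v 1] assms(2) by (simp add: mean_zero_space_iff)

lemma kernel_meet_mean_zero:
  assumes "pos_def_on A V" "x \<in> V" "A *v x = 0"
  shows "x = 0"
  using assms by (force simp: pos_def_on_def)

text \<open>Subtracting the mean stays in the kernel and leaves a mean-zero vector, which
  definiteness forces to vanish.\<close>

lemma kernel_eq_span_one: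
  fixes A :: "real^'n^'n"
  assumes A: "pos_def_on A mean_zero_space" "A *v 1 = 0" and v: "A *v v = 0"
  obtains \<alpha> where "v = \<alpha> *\<^sub>R 1"
proof -
  define \<alpha> where "\<alpha> = v \<bullet> 1 / real CARD('n)"
  have "v - \<alpha> *\<^sub>R 1 \<in> mean_zero_space"
    by (simp add: \<alpha>_def mean_zero_space_iff inner_diff_left inner_one_one)
  moreover have "A *v (v - \<alpha> *\<^sub>R 1) = 0"
    using A v by (simp add: matrix_vector_mult_diff_distrib matrix_vector_mult_scaleR)
  ultimately have "v - \<alpha> *\<^sub>R 1 = 0" by (rule kernel_meet_mean_zero[OF A(1)])
  then show ?thesis using that by simp
qed

text \<open>The form at \<open>x\<close> is the form of \<open>L\<close> at \<open>M *v x\<close>, a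
  nonzero mean-zero vector. This serves the case \<open>D = mat 1\<close>, where \<open>M\<close> is
  the weight.\<close>

lemma pos_def_sandwich:
  fixes L M :: "real^'n^'n"
  assumes L: "pos_def_on L mean_zero_space"
    and M: "pos_def_on M mean_zero_space" "M *v 1 = 0"
  shows "pos_def_on (M ** L ** M) mean_zero_space"
  unfolding pos_def_on_def
proof (intro conjI ballI impI)
  have sym: "transpose L = L" "transpose M = M" using L M by (auto simp: pos_def_on_def)
  then show "transpose (M ** L ** M) = M ** L ** M"
    by (simp add: matrix_transpose_mul matrix_mul_assoc)
  fix x :: "real^'n" assume x: "x \<in> mean_zero_space" "x \<noteq> 0"
  have "M *v x \<noteq> 0" using kernel_meet_mean_zero[OF M(1)] x by blast
  moreover have "M *v x \<in> mean_zero_space" by (rule range_mean_zero[OF sym(2) M(2)])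
  ultimately have "0 < (M *v x) \<bullet> (L *v (M *v x))" using L by (simp add: pos_def_on_def)
  then show "0 < x \<bullet> ((M ** L ** M) *v x)"
    unfolding matrix_vector_mul_assoc[symmetric] by (simp add: inner_matrix_symmetric[OF sym(2)])
qed

text \<open>
  Wigner's argument: minimising \<open>x \<bullet> L D M x / x \<bullet> L x\<close> over the mean-zero space
  gives \<open>D M x = \<mu> x + \<alpha> 1\<close>, and pairing this with \<open>M x\<close> shows that \<open>\<mu> > 0\<close>.
\<close>

lemma pos_def_symmetric_triple_product:
  fixes L D M :: "real^'n^'n"
  assumes card: "CARD('n) \<ge> 2"
    and L: "pos_def_on L mean_zero_space" "L *v 1 = 0"
    and D: "pos_def_on D UNIV"
    and M: "pos_def_on M mean_zero_space" "M *v 1 = 0"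
    and sym: "transpose (L ** D ** M) = L ** D ** M"
  shows "pos_def_on (L ** D ** M) mean_zero_space"
proof -
  let ?H = "mean_zero_space :: (real^'n) set" and ?Q = "L ** D ** M"
  have Ls: "transpose L = L" and Ms: "transpose M = M" using L M by (auto simp: pos_def_on_def)
  have Qv: "?Q *v v = L *v (D *v (M *v v))" for v by (simp add: matrix_vector_mul_assoc matrix_mul_assoc)
  obtain \<mu> x where x: "x \<in> ?H" "x \<noteq> 0"
    and eq: "\<And>y. y \<in> ?H \<Longrightarrow> y \<bullet> (?Q *v x) = \<mu> * (y \<bullet> (L *v x))"
    and le: "\<And>y. y \<in> ?H \<Longrightarrow> \<mu> * (y \<bullet> (L *v y)) \<le> y \<bullet> (?Q *v y)"
    by (rule rayleigh_minimizer[OF subspace_mean_zero mean_zero_nontrivial[OF card] sym L(1)])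
      (rule that; assumption)
  \<comment> \<open>The minimiser's equation holds only against mean-zero vectors, but its residual
    \<open>L *v z\<close> is one of them. So the residual vanishes and \<open>z\<close> is constant,
    though possibly nonzero.\<close>
  define z where "z = D *v (M *v x) - \<mu> *\<^sub>R x"
  have Lz: "L *v z = ?Q *v x - \<mu> *\<^sub>R (L *v x)"
    by (simp add: z_def Qv matrix_vector_mult_diff_distrib matrix_vector_mult_scaleR)
  have "L *v z \<in> ?H" by (rule range_mean_zero[OF Ls L(2)])
  from eq[OF this] have "(L *v z) \<bullet> (L *v z) = 0"
    by (subst (2) Lz) (simp add: inner_diff_right)
  then have "L *v z = 0" by simp
  then obtain \<alpha> where "z = \<alpha> *\<^sub>R 1" using kernel_eq_span_one[OF L] by blast
  then have DM: "D *v (M *v x) = \<mu> *\<^sub>R x + \<alpha> *\<^sub>R 1" by (simp add: z_def algebra_simps)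
  have Mx: "M *v x \<noteq> 0" using kernel_meet_mean_zero[OF M(1)] x by blast
  \<comment> \<open>Orthogonality to the ones removes the unknown \<open>\<alpha>\<close> and
    exhibits \<open>\<mu>\<close> as a quotient of two positive numbers.\<close>
  have "(M *v x) \<bullet> 1 = 0"
    using range_mean_zero[OF Ms M(2), of x] by (simp add: mean_zero_space_iff)
  then have "(M *v x) \<bullet> (D *v (M *v x)) = \<mu> * (x \<bullet> (M *v x))"
    by (simp add: DM inner_add_right inner_commute)
  moreover have "0 < (M *v x) \<bullet> (D *v (M *v x))" using D Mx by (simp add: pos_def_on_def)
  moreover have "0 < x \<bullet> (M *v x)" using M x by (simp add: pos_def_on_def)
  ultimately have "\<mu> > 0" by (simp add: zero_less_mult_iff)
  have "0 < y \<bullet> (?Q *v y)" if "y \<in> ?H" "y \<noteq> 0" for y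
  proof -
    have "0 < y \<bullet> (L *v y)" using L(1) that by (simp add: pos_def_on_def)
    with \<open>\<mu> > 0\<close> have "0 < \<mu> * (y \<bullet> (L *v y))" by simp
    also have "\<dots> \<le> y \<bullet> (?Q *v y)" by (rule le[OF that(1)])
    finally show ?thesis .
  qed
  with sym show ?thesis by (simp add: pos_def_on_def)
qed

theorem theorem1:
  fixes Gc Gc_or Gel :: "('n::finite) pair_pre_digraph"
    and a w :: "'n \<Rightarrow> 'n \<Rightarrow> real" and d :: "'n \<Rightarrow> real" and k\<^sub>I :: real
    and L D M Q :: "real^'n^'n"
  assumes "CARD('n) \<ge> 2"
    and "pair_graph Gc" and "pverts Gc = UNIV"
    and "Digraph_Component.connected (with_proj Gc)"
    and "\<And>i j. (i, j) \<in> parcs Gc \<Longrightarrow> a i j = a j i \<and> a i j > 0"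
    and "orientation_of Gc_or Gc"
    and "k\<^sub>I > 0"
    and "L = k\<^sub>I *\<^sub>R laplacian (with_proj Gc_or) (case_prod a)"
    and "pair_digraph Gel" and "pverts Gel = UNIV"
    and "Digraph_Component.connected (with_proj Gel)"
    and "\<And>i j. (i, j) \<in> parcs Gel \<Longrightarrow> w i j > 0"
    and "M = laplacian (with_proj Gel) (case_prod w)"
    and "\<And>i. d i > 0" and "D = diag_matrix d"
    and "Q = L ** D ** M"
    and "D = mat 1 \<or> (D \<noteq> mat 1 \<and> L ** D ** M = M ** D ** L)"
  shows "glob_exp_stable_on (- Q) mean_zero_space \<and>
    (\<exists>\<eta>. is_least_pos_eigenvalue Q \<eta> \<and> glob_exp_stable_on_rate (- Q) mean_zero_space \<eta>)"
proof -
  let ?H = "mean_zero_space :: (real^'n) set"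
  let ?Lc = "laplacian (with_proj Gc_or) (case_prod a)"
  have Lv: "L *v v = k\<^sub>I *\<^sub>R (?Lc *v v)" for v
    by (simp add: assms(8) scaleR_matrix_vector_assoc)
  \<comment> \<open>The orientation keeps one direction of each edge; connectedness is known for
    \<open>Gc\<close>, while the Laplacian is formed from \<open>Gc_or\<close>.\<close>
  have arcs: "parcs Gc = parcs Gc_or \<union> (parcs Gc_or)\<inverse>"
    using assms(6) by (auto simp: orientation_of_def)
  have "pos_def_on ?Lc ?H"
    using assms(5) arcs by (intro pos_def_laplacian[OF assms(4,3)]) auto
  then have L: "pos_def_on L ?H"
    using assms(7) by (simp add: pos_def_on_def Lv) (simp add: assms(8) transpose_scalar)
  have L1: "L *v 1 = 0" by (simp add: Lv laplacian_mult_one)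
  have M: "pos_def_on M ?H"
    using assms(12) unfolding assms(13) by (intro pos_def_laplacian[OF assms(11,10)]) auto
  have M1: "M *v 1 = 0" by (simp add: assms(13) laplacian_mult_one)
  have D: "pos_def_on D UNIV" using assms(14,15) pos_def_diag_matrix by blast
  have sym: "transpose L = L" "transpose D = D" "transpose M = M"
    using L D M by (auto simp: pos_def_on_def)
  \<comment> \<open>The rightmost factor \<open>M\<close> annihilates the ones; the leftmost factor
    \<open>L\<close> puts the range into the mean-zero space.\<close>
  have Q1: "Q *v 1 = 0"
    using M1 by (simp add: assms(16) matrix_vector_mul_assoc[symmetric])
  have range: "Q *v v \<in> ?H" for v
    using range_mean_zero[OF sym(1) L1] by (simp add: assms(16) matrix_vector_mul_assoc[symmetric])
  obtain A where "pos_def_on A ?H" "pos_def_on (A ** Q) ?H"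
  proof (cases "D = mat 1")
    case True
    then have "pos_def_on (M ** Q) ?H"
      using pos_def_sandwich[OF L M M1] by (simp add: assms(16) matrix_mul_assoc)
    with M that show ?thesis by blast
  next
    case False
    \<comment> \<open>Transposition reverses a product of symmetric matrices, so the commutation
      hypothesis says exactly that \<open>Q\<close> is symmetric.\<close>
    then have "transpose (L ** D ** M) = L ** D ** M"
      using assms(17) sym by (simp add: matrix_transpose_mul matrix_mul_assoc)
    then have "pos_def_on (mat 1 ** Q) ?H"
      using pos_def_symmetric_triple_product[OF assms(1) L L1 D M M1] by (simp add: assms(16))
    moreover have "pos_def_on (mat 1) ?H" by (simp add: pos_def_on_def transpose_mat)
    ultimately show ?thesis using that by blast
  qed
  then have "\<exists>\<eta>. is_least_pos_eigenvalue Q \<eta> \<and> glob_exp_stable_on_rate (- Q) ?H \<eta>"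
    by (rule exp_stable_of_weighted_self_adjoint[OF assms(1) _ _ Q1 range])
  then show ?thesis by (auto simp: glob_exp_stable_on_def)
qed

end
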